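(* Let $k\ge1$ and $n\ge3$ be integers with $n$ odd, and let $\Psi_n(x)=(x^n-1)/\Phi_n(x)$. Then \[(\log\Psi_n)^{(k)}(-1)=(-1)^k\sum_{j=1}^k\frac{B_j^+\,s(k,j)\,(2^j-1)}{j}\big(n^j-J_j(n)\big).\]
   Context: $\Phi_n$ is the $n$-th cyclotomic polynomial, and $\Psi_n$ (the inverse cyclotomic polynomial) is as defined in the claim. $(\log f)^{(k)}$ means $(f'/f)^{(k-1)}$. $s(k,j)$: signed Stirling numbers of the first kind ($x(x-1)\cdots(x-k+1)=\sum_j s(k,j)x^j$); $B_j^+$: $\frac{te^t}{e^t-1}=\sum_j B_j^+t^j/j!$; $J_j(n)=n^j\prod_{p\mid n}(1-p^{-j})$. *)

theory Defs
  imports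
    "HOL-Complex_Analysis.Complex_Analysis"
    "HOL-Computational_Algebra.Computational_Algebra"
begin

definition primitive_roots_unity :: "nat \<Rightarrow> complex set" where
  "primitive_roots_unity n = {z. z ^ n = 1 \<and> (\<forall>m\<in>{1..<n}. z ^ m \<noteq> 1)}"

definition cyclotomic :: "nat \<Rightarrow> complex poly" where
  "cyclotomic n = (\<Prod>z\<in>primitive_roots_unity n. [:- z, 1:])"

text \<open>The polynomial division is exact for \<open>n > 0\<close>; see \<open>inverse_cyclotomic_times_cyclotomic\<close> below.\<close>

definition inverse_cyclotomic :: "nat \<Rightarrow> complex poly" where
  "inverse_cyclotomic n = (monom 1 n - 1) div cyclotomic n"

text \<open>
  The \<open>k\<close>-th derivative (\<open>k \<ge> 1\<close>) of \<open>log f\<close>, read as the \<open>(k - 1)\<close>-st derivative of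
  \<open>f' / f\<close>, so that no branch of the logarithm is involved. Junk value for \<open>k = 0\<close>.
\<close>

definition log_nth_deriv :: "nat \<Rightarrow> (complex \<Rightarrow> complex) \<Rightarrow> complex \<Rightarrow> complex" where
  "log_nth_deriv k f = (deriv ^^ (k - 1)) (\<lambda>z. deriv f z / f z)"

text \<open>Signed; the library function \<open>stirling\<close> is unsigned.\<close>

definition signed_stirling :: "nat \<Rightarrow> nat \<Rightarrow> int" where
  "signed_stirling k j = coeff (\<Prod>i<k. [:- int i, 1:]) j"

text \<open>
  The convention with \<open>B\<^sub>1 = 1/2\<close>. The denominator has subdegree 1, but so has the numerator, and
  division of formal power series over a field is exact in this case.
\<close>

definition bernoulli_plus :: "nat \<Rightarrow> real" where
  "bernoulli_plus j = fact j * fps_nth (fps_X * fps_exp 1 / (fps_exp 1 - 1)) j"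

definition jordan_totient :: "nat \<Rightarrow> nat \<Rightarrow> real" where
  "jordan_totient j n = real n ^ j * (\<Prod>p\<in>prime_factors n. 1 - 1 / real p ^ j)"

lemma prod_linear_factors_dvd:
  fixes p :: "complex poly"
  assumes "finite A" "\<And>a. a \<in> A \<Longrightarrow> poly p a = 0"
  shows "(\<Prod>a\<in>A. [:- a, 1:]) dvd p"
  using assms
proof (induction A arbitrary: p rule: finite_induct)
  case (insert b A)
  obtain q where q: "p = [:- b, 1:] * q"
    using insert.prems[of b] by (auto simp: poly_eq_0_iff_dvd)
  have "poly q a = 0" if "a \<in> A" for a
    using insert.prems[of a] insert.hyps that by (auto simp: q)
  from insert.IH[OF this] insert.hyps show ?case
    by (simp add: q mult_dvd_mono del: mult_pCons_left)
qed simp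

lemma inverse_cyclotomic_times_cyclotomic:
  assumes "n > 0"
  shows "inverse_cyclotomic n * cyclotomic n = monom 1 n - 1"
proof -
  have "finite (primitive_roots_unity n)"
    by (rule finite_subset[OF _ finite_nth_roots[OF assms, of 1]])
       (auto simp: primitive_roots_unity_def)
  hence "cyclotomic n dvd monom 1 n - 1"
    unfolding cyclotomic_def
    by (rule prod_linear_factors_dvd) (auto simp: primitive_roots_unity_def poly_monom)
  thus ?thesis by (simp add: inverse_cyclotomic_def)
qed

end

theory Submission
  imports Defs
begin

text \<open>
  Put \<open>x = - exp u\<close>. The Euler operator \<open>x d/dx\<close> becomes \<open>d/du\<close>, and
  \<open>x ^ k (d/dx) ^ k = (\<Sum>j. s(k,j) (x d/dx) ^ j)\<close>. For odd \<open>m\<close> the logarithmic Euler derivative of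
  \<open>x ^ m - 1\<close> is \<open>m exp (m u) / (exp (m u) + 1)\<close>, whose Taylor coefficients at \<open>0\<close> come from the
  generating function \<open>g t = t exp t / (exp t - 1)\<close> through \<open>g (2 t) - g t = t exp t / (exp t + 1)\<close>.
  Since \<open>x ^ n - 1\<close> is the product of the \<open>\<Phi>\<^sub>d\<close> over \<open>d dvd n\<close> and \<open>n ^ j\<close> is the sum of the \<open>J\<^sub>j(d)\<close>,
  the values for \<open>\<Phi>\<^sub>n\<close>, and hence those for \<open>\<Psi>\<^sub>n\<close>, follow by strong induction on \<open>n\<close>.
\<close>

section \<open>Divisor sums of the Jordan totient\<close>

lemma jordan_totient_mult_coprime:
  assumes "coprime a b" "a > 0" "b > 0"
  shows "jordan_totient j (a * b) = jordan_totient j a * jordan_totient j b"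
proof -
  have "prime_factors (a * b) = prime_factors a \<union> prime_factors b"
    using assms by (intro prime_factors_product) auto
  moreover have "prime_factors a \<inter> prime_factors b = {}"
    using assms(1) by (meson coprime_common_divisor disjoint_iff in_prime_factors_iff not_prime_unit)
  ultimately show ?thesis
    by (simp add: jordan_totient_def prod.union_disjoint power_mult_distrib)
qed

lemma jordan_totient_prime_power_Suc:
  assumes "prime p"
  shows "jordan_totient j (p ^ Suc i) = (real p ^ j) ^ Suc i - (real p ^ j) ^ i"
proof -
  have "prime_factors (p ^ Suc i) = {p}"
    using assms by (auto simp: prime_factors_dvd simp del: power_Suc
                         dest: prime_dvd_power primes_dvd_imp_eq)
  moreover have "real p ^ j \<noteq> 0" using assms by auto
  ultimately show ?thesis
    by (simp add: jordan_totient_def field_simps flip: power_mult power_add)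
qed

lemma sum_jordan_totient_prime_power:
  assumes "prime p"
  shows "(\<Sum>i\<le>a. jordan_totient j (p ^ i)) = (real p ^ j) ^ a"
proof (induction a)
  case (Suc a)
  thus ?case using jordan_totient_prime_power_Suc[OF assms] by simp
qed (simp add: jordan_totient_def)

text \<open>Strong induction splits off the full power \<open>p ^ a\<close> of one prime. The
  divisors of \<open>p ^ a * m\<close> are the products \<open>p ^ i * d\<close> with
  \<open>i \<le> a\<close> and \<open>d dvd m\<close>, each obtained once, so multiplicativity
  factors the sum into a telescoping sum over the powers of \<open>p\<close> and the sum for
  \<open>m\<close>.\<close>

lemma sum_jordan_totient_divisors:
  assumes "n > 0"
  shows "(\<Sum>d | d dvd n. jordan_totient j d) = real n ^ j"
  using assms
proof (induction n rule: less_induct)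
  case (less n)
  show ?case
  proof (cases "n = 1")
    case True
    thus ?thesis by (simp add: jordan_totient_def)
  next
    case False
    then obtain p where p: "prime p" "p dvd n" using prime_factor_nat by blast
    obtain m where m: "n = p ^ multiplicity p n * m" "\<not> p dvd m"
      using less.prems p by (metis multiplicity_decompose' not_prime_unit not_gr_zero)
    define a where "a = multiplicity p n"
    have a: "a > 0" using p less.prems by (simp add: a_def prime_multiplicity_gt_zero_iff)
    have n: "n = p ^ a * m" using m(1) by (simp add: a_def)
    have m0: "m > 0" using less.prems n by (cases m) auto
    have "1 < p ^ a" using a prime_gt_1_nat[OF p(1)] by (intro one_less_power)
    hence "m < n" using n m0 by simp
    have cop: "coprime (p ^ i) d" if "d dvd m" for i d
      using that m(2) p(1) by (meson coprime_power_left_iff dvd_trans prime_imp_coprime)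
    have inj: "inj_on (\<lambda>(i, d). p ^ i * d) ({..a} \<times> {d. d dvd m})"
    proof (rule inj_onI, clarify)
      fix i d i' d'
      assume d: "d dvd m" "d' dvd m" and eq: "p ^ i * d = p ^ i' * d'"
      \<comment> \<open>The exponent is recovered as the multiplicity of \<open>p\<close>, because
        \<open>p\<close> divides no divisor of \<open>m\<close>; cancelling the power of
        \<open>p\<close> then recovers \<open>d\<close>.\<close>
      have *: "multiplicity p (p ^ i * d) = i" if "d dvd m" for i d
      proof -
        have "\<not> p dvd d" using that m(2) dvd_trans by blast
        thus ?thesis using p(1) by (intro multiplicity_eqI) auto
      qed
      have "i = i'" using *[OF d(1), of i] *[OF d(2), of i'] eq by simp
      thus "i = i' \<and> d = d'" using eq p(1) by auto
    qed
    have img: "(\<lambda>(i, d). p ^ i * d) ` ({..a} \<times> {d. d dvd m}) = {d. d dvd n}"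
    proof (intro equalityI subsetI)
      fix x assume "x \<in> {d. d dvd n}"
      then obtain b d where bd: "x = b * d" "b dvd p ^ a" "d dvd m"
        unfolding n using division_decomp by blast
      then obtain i where "i \<le> a" "b = p ^ i" using p(1) divides_primepow_nat by blast
      thus "x \<in> (\<lambda>(i, d). p ^ i * d) ` ({..a} \<times> {d. d dvd m})" using bd by force
    qed (auto simp: n intro!: mult_dvd_mono le_imp_power_dvd)
    have "(\<Sum>d | d dvd n. jordan_totient j d)
        = (\<Sum>(i, d) \<in> {..a} \<times> {d. d dvd m}. jordan_totient j (p ^ i * d))"
      unfolding img[symmetric] by (subst sum.reindex[OF inj]) (simp add: case_prod_unfold)
    also have "\<dots> = (\<Sum>(i, d) \<in> {..a} \<times> {d. d dvd m}.
        jordan_totient j (p ^ i) * jordan_totient j d)"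
      using cop p(1) m0
      by (intro sum.cong) (auto intro!: jordan_totient_mult_coprime simp: prime_gt_0_nat dvd_pos_nat)
    also have "\<dots> = (\<Sum>i\<le>a. jordan_totient j (p ^ i)) * (\<Sum>d | d dvd m. jordan_totient j d)"
      by (simp add: sum_product sum.cartesian_product)
    also have "\<dots> = real n ^ j"
      using less.IH[OF \<open>m < n\<close> m0] sum_jordan_totient_prime_power[OF p(1)]
      by (simp add: n power_mult_distrib power_mult[symmetric] mult.commute)
    finally show ?thesis .
  qed
qed

section \<open>The cyclotomic factorisation\<close>

text \<open>Only \<open>n mod d\<close> matters, and a nonzero remainder is excluded by the
  minimality of \<open>d\<close>. Positivity of \<open>d\<close> matters:
  \<open>primitive_roots_unity 0\<close> is the whole complex plane.\<close>

lemma primitive_root_power_eq_1_iff: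
  assumes "z \<in> primitive_roots_unity d" "d > 0"
  shows "z ^ n = 1 \<longleftrightarrow> d dvd n"
proof -
  have zd: "z ^ d = 1" and min: "\<And>m. 1 \<le> m \<Longrightarrow> m < d \<Longrightarrow> z ^ m \<noteq> 1"
    using assms(1) by (auto simp: primitive_roots_unity_def)
  have "z ^ n = z ^ (d * (n div d) + n mod d)" by simp
  also have "\<dots> = z ^ (n mod d)" by (simp only: power_add power_mult zd) simp
  finally have "z ^ n = z ^ (n mod d)" .
  thus ?thesis
    using min[of "n mod d"] assms(2) by (cases "n mod d = 0") (auto simp: dvd_eq_mod_eq_0)
qed

lemma roots_unity_eq_UN_primitive:
  assumes "n > 0"
  shows "{z. z ^ n = 1} = (\<Union>d\<in>{d. d dvd n}. primitive_roots_unity d)"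
proof (intro equalityI subsetI)
  fix z :: complex
  assume "z \<in> {z. z ^ n = 1}"
  hence zn: "z ^ n = 1" by simp
  \<comment> \<open>The multiplicative order of \<open>z\<close> selects the class of primitive
    roots that contains it.\<close>
  define d where "d = (LEAST d. d > 0 \<and> z ^ d = 1)"
  have d: "d > 0 \<and> z ^ d = 1"
    unfolding d_def by (rule LeastI[of _ n]) (use assms zn in auto)
  have "z \<in> primitive_roots_unity d"
    using d not_less_Least[of _ "\<lambda>d. d > 0 \<and> z ^ d = 1", folded d_def]
    by (fastforce simp: primitive_roots_unity_def)
  thus "z \<in> (\<Union>d\<in>{d. d dvd n}. primitive_roots_unity d)"
    using primitive_root_power_eq_1_iff d zn by blast
next
  fix z assume "z \<in> (\<Union>d\<in>{d. d dvd n}. primitive_roots_unity d)"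
  thus "z \<in> {z. z ^ n = 1}"
    using assms primitive_root_power_eq_1_iff dvd_pos_nat by blast
qed

lemma finite_primitive_roots_unity:
  assumes "n > 0"
  shows "finite (primitive_roots_unity n)"
  by (rule finite_subset[OF _ finite_nth_roots[OF assms, of 1]])
     (auto simp: primitive_roots_unity_def)

lemma degree_monom_diff_1:
  assumes "n > 0"
  shows "degree (monom 1 n - 1 :: 'a :: comm_ring_1 poly) = n"
    and "lead_coeff (monom 1 n - 1 :: 'a poly) = 1"
proof -
  have "degree (- 1 :: 'a poly) < degree (monom 1 n :: 'a poly)"
    using assms by (simp add: degree_monom_eq)
  thus "degree (monom 1 n - 1 :: 'a poly) = n"
    using degree_add_eq_left[of "- 1 :: 'a poly" "monom 1 n"] by (simp add: degree_monom_eq)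
  thus "lead_coeff (monom 1 n - 1 :: 'a poly) = 1"
    using assms by simp
qed

text \<open>The linear factors belong to distinct roots, so their product divides
  \<open>monom 1 n - 1\<close>. There are \<open>n\<close> roots of unity, hence both polynomials
  are monic of degree \<open>n\<close> and the cofactor is 1.\<close>

lemma prod_roots_unity_eq:
  assumes "n > 0"
  shows "(\<Prod>z | z ^ n = 1. [:- z, 1:]) = (monom 1 n - 1 :: complex poly)"
proof -
  let ?q = "\<Prod>z | z ^ n = 1. [:- z, 1:] :: complex poly" and ?p = "monom 1 n - 1 :: complex poly"
  have "?q dvd ?p"
    using finite_nth_roots[OF assms, of 1]
    by (intro prod_linear_factors_dvd) (auto simp: poly_monom)
  then obtain r where r: "?p = ?q * r" by (elim dvdE)
  have q: "degree ?q = n"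
    using card_nth_roots[of 1 n] assms by (simp add: degree_prod_eq_sum_degree)
  have lq: "lead_coeff ?q = 1" by (simp only: lead_coeff_prod) simp
  have p: "degree ?p = n" "lead_coeff ?p = 1"
    using degree_monom_diff_1[OF assms] by blast+
  have "?p \<noteq> 0" using p(2) by force
  hence "?q \<noteq> 0" "r \<noteq> 0" using r by auto
  hence "degree ?p = degree ?q + degree r" unfolding r by (rule degree_mult_eq)
  hence "degree r = 0" using p q by simp
  moreover have "lead_coeff r = 1"
    using p(2) lq by (simp only: r lead_coeff_mult) simp
  ultimately have "r = 1" by (auto elim!: degree_eq_zeroE)
  thus ?thesis using r by simp
qed

lemma prod_cyclotomic_divisors:
  assumes "n > 0"
  shows "(\<Prod>d | d dvd n. cyclotomic d) = monom 1 n - 1"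
proof -
  have "(\<Prod>d | d dvd n. cyclotomic d)
      = (\<Prod>z\<in>(\<Union>d\<in>{d. d dvd n}. primitive_roots_unity d). [:- z, 1:])"
    unfolding cyclotomic_def
  proof (rule prod.UNION_disjoint[symmetric])
    show "\<forall>d\<in>{d. d dvd n}. finite (primitive_roots_unity d)"
      using assms finite_primitive_roots_unity dvd_pos_nat by blast
    show "\<forall>d\<in>{d. d dvd n}. \<forall>e\<in>{d. d dvd n}. d \<noteq> e \<longrightarrow>
        primitive_roots_unity d \<inter> primitive_roots_unity e = {}"
    proof safe
      fix d e z
      assume de: "d dvd n" "e dvd n" "d \<noteq> e"
        and z: "z \<in> primitive_roots_unity d" "z \<in> primitive_roots_unity e"
      have "d > 0" "e > 0" using de assms dvd_pos_nat by blast+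
      \<comment> \<open>Both divisibilities say \<open>z ^ x = 1\<close>; having the same multiples,
        \<open>d\<close> and \<open>e\<close> divide each other.\<close>
      hence "d dvd x \<longleftrightarrow> e dvd x" for x
        using z primitive_root_power_eq_1_iff by blast
      hence "d = e" by (meson dvd_antisym dvd_refl)
      thus "z \<in> {}" using de by simp
    qed
  qed (use assms in auto)
  thus ?thesis
    using prod_roots_unity_eq[OF assms] roots_unity_eq_UN_primitive[OF assms] by simp
qed

lemma poly_monom_diff_1_neg1:
  assumes "odd n"
  shows "poly (monom 1 n - 1) (- 1 :: complex) = - 2"
  using assms by (simp add: poly_monom)

text \<open>The cyclotomic polynomial divides \<open>monom 1 n - 1\<close>, whose value at -1 is -2
  for odd \<open>n\<close>. This makes additivity of the logarithmic derivatives available at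
  -1.\<close>

lemma poly_cyclotomic_neg1_nonzero:
  assumes "odd n"
  shows "poly (cyclotomic n) (- 1) \<noteq> 0"
proof
  assume "poly (cyclotomic n) (- 1) = 0"
  moreover have "n > 0" using assms by (rule odd_pos)
  ultimately have "poly (monom 1 n - 1) (- 1 :: complex) = 0"
    by (simp flip: inverse_cyclotomic_times_cyclotomic)
  thus False using poly_monom_diff_1_neg1[OF assms] by simp
qed

section \<open>Higher logarithmic derivatives\<close>

text \<open>The product rule makes \<open>f' / f\<close> additive. Since
  \<open>log_nth_deriv\<close> differentiates this quotient further, the rule is needed on a
  neighbourhood of \<open>z\<close>; \<open>ev\<close> provides it, as being analytic and being
  nonzero both persist near \<open>z\<close>.\<close>

lemma log_nth_deriv_mult:
  assumes "f analytic_on {z}" "g analytic_on {z}" "f z \<noteq> 0" "g z \<noteq> 0"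
  shows "log_nth_deriv k (\<lambda>w. f w * g w) z = log_nth_deriv k f z + log_nth_deriv k g z"
proof -
  have ev: "\<forall>\<^sub>F w in nhds z. h analytic_on {w} \<and> h w \<noteq> 0"
    if h: "h analytic_on {z}" "h z \<noteq> 0" for h :: "complex \<Rightarrow> complex"
  proof -
    obtain S where S: "open S" "z \<in> S" "h holomorphic_on S"
      using h(1) unfolding analytic_at by blast
    have "open (S \<inter> h -` (- {0}))"
      using continuous_open_preimage[OF holomorphic_on_imp_continuous_on[OF S(3)] S(1)] by auto
    moreover have "z \<in> S \<inter> h -` (- {0})" using S h(2) by auto
    ultimately have "\<forall>\<^sub>F w in nhds z. w \<in> S \<inter> h -` (- {0})" by (rule eventually_nhds_in_open)
    thus ?thesis
    proof eventually_elim
      case (elim w)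
      hence "w \<in> S" by simp
      hence "h analytic_on {w}" unfolding analytic_at using S by blast
      thus ?case using elim by simp
    qed
  qed
  have "\<forall>\<^sub>F w in nhds z. deriv (\<lambda>w. f w * g w) w / (f w * g w) = deriv f w / f w + deriv g w / g w"
    using ev[OF assms(1,3)] ev[OF assms(2,4)]
  proof eventually_elim
    case (elim w)
    hence "f field_differentiable at w" "g field_differentiable at w"
      using analytic_on_imp_differentiable_at by blast+
    thus ?case using elim by (simp add: field_simps)
  qed
  hence "log_nth_deriv k (\<lambda>w. f w * g w) z
      = (deriv ^^ (k - 1)) (\<lambda>w. deriv f w / f w + deriv g w / g w) z"
    unfolding log_nth_deriv_def by (rule higher_deriv_cong_ev) simp
  also have "\<dots> = log_nth_deriv k f z + log_nth_deriv k g z"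
    unfolding log_nth_deriv_def using assms
    by (intro higher_deriv_add_at) (auto intro!: analytic_intros)
  finally show ?thesis .
qed

lemma log_nth_deriv_prod:
  assumes "\<And>i. i \<in> I \<Longrightarrow> f i analytic_on {z}" "\<And>i. i \<in> I \<Longrightarrow> f i z \<noteq> 0"
  shows "log_nth_deriv k (\<lambda>w. \<Prod>i\<in>I. f i w) z = (\<Sum>i\<in>I. log_nth_deriv k (f i) z)"
  using assms
proof (induction I rule: infinite_finite_induct)
  case (insert i I)
  thus ?case by (simp add: log_nth_deriv_mult analytic_on_prod)
\<comment> \<open>An empty or infinite index set gives the constant function 1, whose logarithmic
  derivatives vanish.\<close>
qed (simp_all add: log_nth_deriv_def)

section \<open>Signed Stirling numbers and powers of the Euler operator\<close>

lemma signed_stirling_Suc_Suc: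
  "signed_stirling (Suc k) (Suc i) = signed_stirling k i - int k * signed_stirling k (Suc i)"
  by (simp add: signed_stirling_def mult.commute[of "prod _ _"])

lemma signed_stirling_Suc_0: "signed_stirling (Suc k) 0 = 0"
proof -
  have "poly (\<Prod>i<Suc k. [:- int i, 1:]) 0 = 0" by (auto simp: poly_prod)
  thus ?thesis by (simp only: signed_stirling_def poly_0_coeff_0)
qed

lemma signed_stirling_eq_0:
  assumes "k < j"
  shows "signed_stirling k j = 0"
proof -
  have "degree (\<Prod>i<k. [:- int i, 1:]) = k" by (simp add: degree_prod_eq_sum_degree)
  thus ?thesis using assms by (simp add: signed_stirling_def coeff_eq_0)
qed

lemma signed_stirling_1_1: "signed_stirling (Suc 0) (Suc 0) = 1"
  by (simp add: signed_stirling_def)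

text \<open>This is the expansion of \<open>x^k (d/dx)^k\<close> in powers of the Euler operator,
  applied to a logarithm: with \<open>G = f' / f\<close> one derivative is already taken on either
  side, hence the shifts to \<open>Suc k\<close> and \<open>Suc i\<close>. The induction
  differentiates both sides with respect to \<open>u\<close> and uses the Stirling recurrence.
  Taking \<open>c = -1\<close> makes \<open>u = 0\<close> correspond to
  \<open>x = -1\<close>.\<close>

lemma higher_deriv_euler:
  fixes G :: "complex \<Rightarrow> complex"
  assumes G: "G holomorphic_on U" and U: "open U" and u: "c * exp u \<in> U"
  shows "(c * exp u) ^ Suc k * (deriv ^^ k) G (c * exp u) =
    (\<Sum>i\<le>k. of_int (signed_stirling (Suc k) (Suc i)) *
      (deriv ^^ i) (\<lambda>u. c * exp u * G (c * exp u)) u)"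
  using u
proof (induction k arbitrary: u)
  case 0
  thus ?case by (simp add: signed_stirling_1_1)
next
  case (Suc k)
  define H where "H = (\<lambda>u. c * exp u * G (c * exp u))"
  define V where "V = (\<lambda>u. c * exp u) -` U"
  define s where "s = (\<lambda>i. of_int (signed_stirling (Suc k) i) :: complex)"
  define w where "w = c * exp u"
  have V: "open V" unfolding V_def by (intro open_vimage U continuous_intros)
  have uV: "u \<in> V" using Suc.prems by (simp add: V_def)
  have H: "H holomorphic_on V"
  proof -
    have e: "(\<lambda>u. c * exp u) holomorphic_on V" by (intro holomorphic_intros)
    have "(G \<circ> (\<lambda>u. c * exp u)) holomorphic_on V"
      by (rule holomorphic_on_compose_gen[OF e G]) (auto simp: V_def)
    thus ?thesis unfolding H_def o_def by (intro holomorphic_on_mult[OF e])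
  qed
  have dG: "((deriv ^^ k) G has_field_derivative (deriv ^^ Suc k) G w) (at w)"
    using holomorphic_derivI[OF holomorphic_higher_deriv[OF G U] U] Suc.prems
    by (simp add: w_def)
  have dH: "((deriv ^^ i) H has_field_derivative (deriv ^^ Suc i) H u) (at u)" for i
    using holomorphic_derivI[OF holomorphic_higher_deriv[OF H V] V uV] by simp
  have de: "((\<lambda>u. c * exp u) has_field_derivative w) (at u)"
    unfolding w_def by (auto intro!: derivative_eq_intros)
  have "((\<lambda>u. (c * exp u) ^ Suc k * (deriv ^^ k) G (c * exp u)) has_field_derivative
      of_nat (Suc k) * w ^ Suc k * (deriv ^^ k) G w + w ^ Suc (Suc k) * (deriv ^^ Suc k) G w) (at u)"
    using DERIV_mult[OF DERIV_power[OF de, of "Suc k"]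
        DERIV_chain2[where f = "(deriv ^^ k) G" and g = "\<lambda>u. c * exp u", OF dG[unfolded w_def] de]]
    by (simp add: w_def algebra_simps del: funpow.simps)
  moreover have "((\<lambda>u. \<Sum>i\<le>k. s (Suc i) * (deriv ^^ i) H u) has_field_derivative
      (\<Sum>i\<le>k. s (Suc i) * (deriv ^^ Suc i) H u)) (at u)"
    by (intro DERIV_sum DERIV_cmult dH)
  \<comment> \<open>The induction hypothesis holds throughout the open set \<open>V\<close>, not
    only at \<open>u\<close>, so both of its sides have the same derivative.\<close>
  hence "((\<lambda>u. (c * exp u) ^ Suc k * (deriv ^^ k) G (c * exp u)) has_field_derivative
      (\<Sum>i\<le>k. s (Suc i) * (deriv ^^ Suc i) H u)) (at u)"
    by (rule has_field_derivative_transform_within_open[OF _ V uV])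
       (use Suc.IH in \<open>simp add: V_def s_def H_def\<close>)
  ultimately have eq: "of_nat (Suc k) * w ^ Suc k * (deriv ^^ k) G w
      + w ^ Suc (Suc k) * (deriv ^^ Suc k) G w = (\<Sum>i\<le>k. s (Suc i) * (deriv ^^ Suc i) H u)"
    by (rule DERIV_unique)
  have "w ^ Suc (Suc k) * (deriv ^^ Suc k) G w = (\<Sum>i\<le>k. s (Suc i) * (deriv ^^ Suc i) H u)
      - of_nat (Suc k) * (w ^ Suc k * (deriv ^^ k) G w)"
    unfolding eq[symmetric] by (simp only: mult.assoc) simp
  also have "w ^ Suc k * (deriv ^^ k) G w = (\<Sum>i\<le>k. s (Suc i) * (deriv ^^ i) H u)"
    using Suc.IH[OF Suc.prems] by (simp add: w_def s_def H_def)
  \<comment> \<open>Both sums are brought to the range \<open>i \<le> Suc k\<close>, so that the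
    recurrence applies term by term. The added coefficients vanish: \<open>s 0\<close> because 0 is
    a root of the falling factorial, \<open>s (Suc (Suc k))\<close> because its index exceeds the
    degree.\<close>
  also have "(\<Sum>i\<le>k. s (Suc i) * (deriv ^^ Suc i) H u) = (\<Sum>i\<le>Suc k. s i * (deriv ^^ i) H u)"
    by (subst sum.atMost_Suc_shift) (simp add: s_def signed_stirling_Suc_0)
  also have "(\<Sum>i\<le>k. s (Suc i) * (deriv ^^ i) H u) = (\<Sum>i\<le>Suc k. s (Suc i) * (deriv ^^ i) H u)"
    by (simp add: s_def signed_stirling_eq_0)
  finally show ?case
    unfolding w_def[symmetric] H_def[symmetric] signed_stirling_Suc_Suc[of "Suc k"]
    by (simp add: s_def sum_distrib_left sum_subtractf[symmetric] algebra_simps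
             del: funpow.simps sum.atMost_Suc)
qed

section \<open>Logarithmic derivatives at \<open>-1\<close>\<close>

text \<open>In \<open>g(2t) - g(t)\<close> the coefficient of \<open>t^j\<close> is that of
  \<open>g\<close> times \<open>2^j - 1\<close>; removing the factor \<open>t\<close> shifts the
  index to \<open>Suc i\<close>. The identity is proved over the reals, where
  \<open>bernoulli_plus\<close> lives, and then carried to complex series coefficient by
  coefficient.\<close>

lemma fps_nth_exp_over_exp_plus_1:
  "fps_nth (fps_exp 1 / (fps_exp 1 + 1)) i =
    complex_of_real (bernoulli_plus (Suc i) * (2 ^ Suc i - 1) / fact (Suc i))"
proof -
  let ?E = "fps_exp 1 :: real fps" and ?E' = "fps_exp 1 :: complex fps"
  \<comment> \<open>\<open>B\<close> is \<open>g(t)\<close>, \<open>B2\<close> is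
    \<open>g(2t)\<close>, and \<open>K\<close> is the complex image of their difference.\<close>
  define B where "B = fps_X * ?E / (?E - 1)"
  define B2 where "B2 = B oo (fps_const 2 * fps_X)"
  define K where "K = Abs_fps (\<lambda>n. complex_of_real (fps_nth (B2 - B) n))"
  have "fps_nth (?E - 1) 1 \<noteq> 0" by simp
  hence E: "?E - 1 \<noteq> 0" by (metis fps_zero_nth)
  have "?E - 1 dvd fps_X * ?E"
  proof -
    have "subdegree (?E - 1) = 1" by (rule subdegreeI) auto
    moreover have "subdegree (fps_X * ?E) = 1" by (rule subdegreeI) auto
    ultimately show ?thesis using E by (simp add: fps_dvd_iff)
  qed
  hence B: "B * (?E - 1) = fps_X * ?E" by (simp add: B_def)
  have E2: "?E oo (fps_const 2 * fps_X) = ?E * ?E"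
    by (simp add: fps_exp_add_mult[symmetric])
  have "B2 * (?E * ?E - 1) = fps_const 2 * fps_X * (?E * ?E)"
    using arg_cong[OF B, of "\<lambda>f. f oo (fps_const 2 * fps_X)"]
    by (simp add: fps_compose_mult_distrib fps_compose_sub_distrib E2 B2_def
             del: fps_exp_compose_linear)
  moreover have "B * (?E - 1) * (?E + 1) = fps_X * ?E * (?E + 1)" by (simp add: B)
  moreover have "fps_const 2 = (2 :: real fps)" by (simp add: numeral_fps_const)
  \<comment> \<open>The common denominator is \<open>?E * ?E - 1 = (?E - 1) * (?E + 1)\<close>, and
    the factor \<open>?E - 1\<close> cancels afterwards.\<close>
  ultimately have "((B2 - B) * (?E + 1)) * (?E - 1) = (fps_X * ?E) * (?E - 1)"
    by (simp add: algebra_simps)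
  hence main: "(B2 - B) * (?E + 1) = fps_X * ?E" using E by simp
  have "K * (?E' + 1) = fps_X * ?E'"
  proof (rule fps_ext)
    fix n
    have "fps_nth (?E' + 1) i = complex_of_real (fps_nth (?E + 1) i)" for i by simp
    hence "fps_nth (K * (?E' + 1)) n = complex_of_real (fps_nth ((B2 - B) * (?E + 1)) n)"
      by (simp only: fps_mult_nth K_def of_real_sum of_real_mult fps_nth_Abs_fps)
    also have "\<dots> = fps_nth (fps_X * ?E') n" by (simp add: main)
    finally show "fps_nth (K * (?E' + 1)) n = fps_nth (fps_X * ?E') n" .
  qed
  also have "\<dots> = fps_X * (?E' / (?E' + 1)) * (?E' + 1)"
  proof -
    have "fps_nth (?E' + 1) 0 \<noteq> 0" by simp
    hence "?E' + 1 dvd ?E'" by (simp add: unit_imp_dvd)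
    thus ?thesis by (simp add: mult.assoc)
  qed
  finally have "K * (?E' + 1) = fps_X * (?E' / (?E' + 1)) * (?E' + 1)" .
  moreover have "fps_nth (?E' + 1) 0 \<noteq> 0" by simp
  hence "?E' + 1 \<noteq> 0" by (metis fps_zero_nth)
  ultimately have "K = fps_X * (?E' / (?E' + 1))" by simp
  hence "fps_nth (?E' / (?E' + 1)) i = fps_nth K (Suc i)" by simp
  also have "\<dots> = complex_of_real (bernoulli_plus (Suc i) * (2 ^ Suc i - 1) / fact (Suc i))"
  proof -
    have "fps_nth B2 (Suc i) = 2 ^ Suc i * fps_nth B (Suc i)" by (simp add: B2_def)
    hence "fps_nth (B2 - B) (Suc i) = fps_nth B (Suc i) * (2 ^ Suc i - 1)"
      by (simp add: algebra_simps)
    moreover have "bernoulli_plus (Suc i) = fact (Suc i) * fps_nth B (Suc i)"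
      by (simp only: bernoulli_plus_def B_def)
    ultimately show ?thesis by (simp only: K_def fps_nth_Abs_fps) simp
  qed
  finally show ?thesis .
qed

text \<open>The derivative is \<open>fact i\<close> times the Taylor coefficient, so
  \<open>fact (Suc i)\<close> in the denominator leaves \<open>Suc i\<close>. The substitution of
  \<open>m u\<close> contributes \<open>m ^ i\<close>, and the outer factor supplies one more
  \<open>m\<close>.\<close>

lemma higher_deriv_exp_over_exp_plus_1:
  fixes m :: nat
  shows "(deriv ^^ i) (\<lambda>u. of_nat m * (exp (of_nat m * u) / (exp (of_nat m * u) + 1))) 0 =
    complex_of_real (bernoulli_plus (Suc i) * (2 ^ Suc i - 1) / real (Suc i) * real m ^ Suc i)"
proof -
  let ?F = "fps_exp 1 / (fps_exp 1 + 1) :: complex fps"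
  have "(\<lambda>u::complex. exp (1 * u) / (exp (1 * u) + 1)) has_fps_expansion ?F"
    by (intro fps_expansion_intros) auto
  moreover have "(\<lambda>u::complex. of_nat m * u) has_fps_expansion (fps_const (of_nat m) * fps_X)"
    by (intro fps_expansion_intros)
  ultimately have "(\<lambda>u. exp (of_nat m * u) / (exp (of_nat m * u) + 1)) has_fps_expansion
      (?F oo (fps_const (of_nat m) * fps_X))"
    using has_fps_expansion_compose by (fastforce simp: o_def)
  hence "(\<lambda>u. of_nat m * (exp (of_nat m * u) / (exp (of_nat m * u) + 1))) has_fps_expansion
      (fps_const (of_nat m) * (?F oo (fps_const (of_nat m) * fps_X)))"
    by (rule has_fps_expansion_cmult_left)
  from fps_nth_fps_expansion[OF this, of i]
  have "(deriv ^^ i) (\<lambda>u. of_nat m * (exp (of_nat m * u) / (exp (of_nat m * u) + 1))) 0 =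
      fact i * (of_nat m * (of_nat m ^ i * fps_nth ?F i))"
    by (simp add: nonzero_eq_divide_eq mult.commute[of _ "fact i"] del: times_divide_eq_right)
  also have "\<dots> = complex_of_real (bernoulli_plus (Suc i) * (2 ^ Suc i - 1) / real (Suc i) * real m ^ Suc i)"
  proof -
    have "fact i * (of_nat m * (of_nat m ^ i * complex_of_real (x / fact (Suc i))))
        = complex_of_real (x / real (Suc i) * real m ^ Suc i)" for x
      by (simp add: fact_Suc[of i, where 'a = complex] del: of_nat_Suc fact_Suc)
    thus ?thesis by (simp only: fps_nth_exp_over_exp_plus_1)
  qed
  finally show ?thesis .
qed

text \<open>Isolates the factor common to all three formulas: the values for \<open>x^m - 1\<close>,
  for the cyclotomic polynomial and for its inverse differ only in whether it multiplies
  \<open>m^j\<close>, the Jordan totient or a difference of the two.\<close>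

definition log_deriv_weight :: "nat \<Rightarrow> nat \<Rightarrow> real" where
  "log_deriv_weight k j =
    bernoulli_plus j * real_of_int (signed_stirling k j) * (2 ^ j - 1) / real j"

lemma log_nth_deriv_monom_diff_1:
  assumes "odd m" "k \<ge> 1"
  shows "log_nth_deriv k (poly (monom 1 m - 1)) (-1) =
    complex_of_real ((-1) ^ k * (\<Sum>j=1..k. log_deriv_weight k j * real m ^ j))"
proof -
  obtain k' where k: "k = Suc k'" using assms(2) by (cases k) auto
  let ?P = "poly (monom 1 m - 1) :: complex \<Rightarrow> complex"
  define G where "G = (\<lambda>z. deriv ?P z / ?P z)"
  have m: "m > 0" using assms(1) by (rule odd_pos)
  have P: "?P = (\<lambda>z. z ^ m - 1)" by (auto simp: poly_monom)
  have dP: "deriv ?P z = of_nat m * z ^ (m - 1)" for z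
    unfolding P by (rule DERIV_imp_deriv) (auto intro!: derivative_eq_intros)
  have U: "open {z. ?P z \<noteq> 0}" by (intro open_Collect_neq continuous_intros)
  have G: "G holomorphic_on {z. ?P z \<noteq> 0}"
    unfolding G_def dP by (intro holomorphic_intros) auto
  have H: "(\<lambda>u. (-1) * exp u * G ((-1) * exp u)) =
      (\<lambda>u. of_nat m * (exp (of_nat m * u) / (exp (of_nat m * u) + 1)))"
  proof
    fix u :: complex
    \<comment> \<open>Oddness of \<open>m\<close> keeps the minus sign, which turns the denominator
      \<open>x^m - 1\<close> into \<open>- (exp (m u) + 1)\<close>, nonzero at
      \<open>u = 0\<close>.\<close>
    have pm: "(- exp u) ^ m = - exp (of_nat m * u)"
      using assms(1) by (simp add: exp_of_nat_mult)
    have "- exp u * (- exp u) ^ (m - 1) = (- exp u) ^ m"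
      using m by (simp flip: power_Suc)
    hence "(-1) * exp u * G ((-1) * exp u) = of_nat m * (- exp u) ^ m / ((- exp u) ^ m - 1)"
      unfolding G_def dP by (simp add: P algebra_simps)
    also have "\<dots> = of_nat m * (- exp (of_nat m * u)) / (- (exp (of_nat m * u) + 1))"
      unfolding pm by simp
    also have "\<dots> = of_nat m * (exp (of_nat m * u) / (exp (of_nat m * u) + 1))"
      by (simp only: mult_minus_right minus_divide_divide times_divide_eq_right)
    finally show "(-1) * exp u * G ((-1) * exp u) = \<dots>" .
  qed
  have "(-1) * exp 0 \<in> {z. ?P z \<noteq> 0}"
    using assms(1) by (simp add: P)
  from higher_deriv_euler[OF G U this, of k']
  have "(-1) ^ k * (deriv ^^ k') G (-1) = (\<Sum>i\<le>k'. of_int (signed_stirling k (Suc i)) *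
      complex_of_real (bernoulli_plus (Suc i) * (2 ^ Suc i - 1) / real (Suc i) * real m ^ Suc i))"
    unfolding H higher_deriv_exp_over_exp_plus_1 k by simp
  also have "\<dots> = complex_of_real (\<Sum>i\<le>k'. log_deriv_weight k (Suc i) * real m ^ Suc i)"
    by (simp add: log_deriv_weight_def field_simps)
  also have "(\<Sum>i\<le>k'. log_deriv_weight k (Suc i) * real m ^ Suc i)
      = (\<Sum>j=1..k. log_deriv_weight k j * real m ^ j)"
    unfolding k by (simp add: sum.atLeast_Suc_atMost_Suc_shift atMost_atLeast0 del: power_Suc sum.cl_ivl_Suc)
  finally have *: "(-1) ^ k * (deriv ^^ k') G (-1)
      = complex_of_real (\<Sum>j=1..k. log_deriv_weight k j * real m ^ j)" .
  \<comment> \<open>The power of the base point -1 in the Euler identity is its own inverse; it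
    becomes the sign in the formula.\<close>
  have "log_nth_deriv k ?P (-1) = (-1) ^ k * ((-1) ^ k * (deriv ^^ k') G (-1))"
    by (simp add: log_nth_deriv_def k G_def flip: power_add mult.assoc)
  thus ?thesis unfolding * by simp
qed

lemma analytic_on_poly [analytic_intros]: "poly p analytic_on A"
  for p :: "complex poly"
  by (rule analytic_on_subset[of _ UNIV]) (auto simp: analytic_on_open intro!: holomorphic_intros)

text \<open>The induction plays the role of Moebius inversion: both sides have the same sum over the
  divisors of \<open>n\<close> and agree at the proper divisors, which are again odd, so they agree
  at \<open>n\<close>.\<close>

lemma log_nth_deriv_cyclotomic:
  assumes "odd n" "k \<ge> 1"
  shows "log_nth_deriv k (poly (cyclotomic n)) (-1) =
    complex_of_real ((-1) ^ k * (\<Sum>j=1..k. log_deriv_weight k j * jordan_totient j n))"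
  using assms(1)
proof (induction n rule: less_induct)
  case (less n)
  define c where "c = (\<lambda>d. (-1) ^ k * (\<Sum>j=1..k. log_deriv_weight k j * jordan_totient j d))"
  let ?L = "\<lambda>d. log_nth_deriv k (poly (cyclotomic d)) (-1)"
  let ?D = "{d. d dvd n}"
  have n: "n > 0" using less.prems by (rule odd_pos)
  have odd: "odd d" if "d dvd n" for d using that less.prems dvd_trans by blast
  have "(\<Sum>d\<in>?D. ?L d) = log_nth_deriv k (\<lambda>w. \<Prod>d\<in>?D. poly (cyclotomic d) w) (-1)"
    using odd poly_cyclotomic_neg1_nonzero
    by (intro log_nth_deriv_prod[symmetric]) (auto intro!: analytic_intros)
  also have "(\<lambda>w. \<Prod>d\<in>?D. poly (cyclotomic d) w) = poly (monom 1 n - 1)"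
    by (simp add: fun_eq_iff prod_cyclotomic_divisors[OF n, symmetric] poly_prod)
  \<comment> \<open>Each \<open>n ^ j\<close> is expanded into its divisor sum of Jordan totients,
    and the sums over \<open>d\<close> and \<open>j\<close> are exchanged.\<close>
  also have "log_nth_deriv k (poly (monom 1 n - 1)) (-1) = complex_of_real (\<Sum>d\<in>?D. c d)"
    unfolding log_nth_deriv_monom_diff_1[OF less.prems assms(2)]
      sum_jordan_totient_divisors[OF n, symmetric] c_def sum_distrib_left
    by (subst sum.swap) simp
  finally have "(\<Sum>d\<in>?D. ?L d) = (\<Sum>d\<in>?D. complex_of_real (c d))" by simp
  moreover have "?L d = complex_of_real (c d)" if "d \<in> ?D - {n}" for d
  proof -
    have "d < n" using that n dvd_imp_le[of d n] by auto
    thus ?thesis using less.IH odd that unfolding c_def by blast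
  qed
  moreover have "finite ?D" "n \<in> ?D" using n by auto
  ultimately have "?L n = complex_of_real (c n)"
    by (simp add: sum.remove[of ?D n])
  thus ?case by (simp only: c_def)
qed

theorem theorem5p13:
  fixes k n :: nat
  assumes "k \<ge> 1" and "n \<ge> 3" and "odd n"
  shows "log_nth_deriv k (poly (inverse_cyclotomic n)) (-1) =
    complex_of_real ((-1) ^ k * (\<Sum>j=1..k.
      bernoulli_plus j * real_of_int (signed_stirling k j) * (2 ^ j - 1) / real j
        * (real n ^ j - jordan_totient j n)))"
proof -
  have n: "n > 0" using assms(2) by simp
  have eq: "(\<lambda>w. poly (inverse_cyclotomic n) w * poly (cyclotomic n) w) = poly (monom 1 n - 1)"
    by (simp add: fun_eq_iff inverse_cyclotomic_times_cyclotomic[OF n, symmetric])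
  \<comment> \<open>The product equals -2, so neither factor vanishes at -1 and the logarithmic
    derivatives add up.\<close>
  have "poly (inverse_cyclotomic n) (-1) * poly (cyclotomic n) (-1) \<noteq> 0"
    using fun_cong[OF eq, of "-1"] poly_monom_diff_1_neg1[OF assms(3)] by (simp only:) simp
  hence "log_nth_deriv k (poly (monom 1 n - 1)) (-1) =
      log_nth_deriv k (poly (inverse_cyclotomic n)) (-1) + log_nth_deriv k (poly (cyclotomic n)) (-1)"
    unfolding eq[symmetric] by (intro log_nth_deriv_mult) (auto intro!: analytic_intros)
  hence "log_nth_deriv k (poly (inverse_cyclotomic n)) (-1) =
      complex_of_real ((-1) ^ k * (\<Sum>j=1..k. log_deriv_weight k j * real n ^ j)) -
      complex_of_real ((-1) ^ k * (\<Sum>j=1..k. log_deriv_weight k j * jordan_totient j n))"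
    using log_nth_deriv_monom_diff_1[OF assms(3,1)] log_nth_deriv_cyclotomic[OF assms(3,1)]
    by (simp add: algebra_simps)
  also have "\<dots> = complex_of_real ((-1) ^ k *
      (\<Sum>j=1..k. log_deriv_weight k j * (real n ^ j - jordan_totient j n)))"
    by (simp only: of_real_diff[symmetric] right_diff_distrib sum_subtractf)
  finally show ?thesis unfolding log_deriv_weight_def .
qed

end
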